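(* Let $A\in\mathbb{R}^{n\times n}$ ($n\ge1$) be such that the directed graph $G$ of $A$ is strongly connected, and let $K\in\mathbb{N}$ be such that $\mathcal{C}_K\neq\emptyset$, where $\mathcal{C}_K=\{S\subset V : |S|=K,\ (A,B(S))\text{ is structurally controllable}\}$. Let $\mathcal{R}_K=\{R\subset V : V\setminus R\in\mathcal{C}_K\}$ and $\tilde{\mathcal{R}}_K=\{Q : \exists\, R\in\mathcal{R}_K\text{ such that }Q\subset R\}$. Then $(V,\tilde{\mathcal{R}}_K)$ is a matroid (with $\tilde{\mathcal R}_K$ as the collection of independent sets).
   Context: $V=\{v_1,\dots,v_n\}$. The directed graph $G=(V,E)$ of $A$ has an edge $(v_j,v_i)\in E$ exactly when $A_{ij}\ne0$. For $S\subset V$, $B(S)\in\mathbb{R}^{n\times n}$ is the diagonal matrix whose $i$th diagonal entry is $1$ if $v_i\in S$ and $0$ otherwise. A pair $(\hat A,\hat B)$ of real $n\times n$ matrices is controllable if $[\hat B\ \ \hat A\hat B\ \cdots\ \hat A^{n-1}\hat B]$ has rank $n$. Two pairs $(A,B)$ and $(\hat A,\hat B)$ have the same structure if the matrices $[A\ B]$ and $[\hat A\ \hat B]$ have zeros at exactly the same entries. $(A,B(S))$ is structurally controllable if there is a controllable pair of real matrices having the same structure as $(A,B(S))$. *)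

theory Defs
  imports
    "Jordan_Normal_Form.DL_Rank"
    "Graph_Theory.Digraph_Component"
begin

(* Vertices v_1, ..., v_n are represented by the indices 0, ..., n - 1. *)

definition matrix_digraph :: "nat \<Rightarrow> real mat \<Rightarrow> nat pair_pre_digraph" where
  "matrix_digraph n A =
     \<lparr> pverts = {0..<n}, parcs = {(j, i). i < n \<and> j < n \<and> A $$ (i, j) \<noteq> 0} \<rparr>"

definition input_mat :: "nat \<Rightarrow> nat set \<Rightarrow> real mat" where
  "input_mat n S = mat n n (\<lambda>(i, j). if i = j \<and> i \<in> S then 1 else 0)"

(* [A B]; the column analogue of the library's append_rows. *)
definition append_cols :: "'a :: zero mat \<Rightarrow> 'a mat \<Rightarrow> 'a mat" where
  "append_cols A B = four_block_mat A B (0\<^sub>m 0 (dim_col A)) (0\<^sub>m 0 (dim_col B))"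

(* [B  AB  ...  A^(n-1)B]: column k * n + j is column j of A^k B, for k, j < n. *)
definition controllability_mat :: "nat \<Rightarrow> real mat \<Rightarrow> real mat \<Rightarrow> real mat" where
  "controllability_mat n A B = mat n (n * n) (\<lambda>(i, c). (A ^\<^sub>m (c div n) * B) $$ (i, c mod n))"

definition controllable :: "nat \<Rightarrow> real mat \<Rightarrow> real mat \<Rightarrow> bool" where
  "controllable n A B \<longleftrightarrow> vec_space.rank n (controllability_mat n A B) = n"

definition same_zeros :: "'a :: zero mat \<Rightarrow> 'a mat \<Rightarrow> bool" where
  "same_zeros M N \<longleftrightarrow> dim_row M = dim_row N \<and> dim_col M = dim_col N \<and>
     (\<forall>i < dim_row M. \<forall>j < dim_col M. M $$ (i, j) = 0 \<longleftrightarrow> N $$ (i, j) = 0)"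

definition same_structure :: "real mat \<times> real mat \<Rightarrow> real mat \<times> real mat \<Rightarrow> bool" where
  "same_structure = (\<lambda>(A, B) (A', B'). same_zeros (append_cols A B) (append_cols A' B'))"

definition structurally_controllable :: "nat \<Rightarrow> real mat \<Rightarrow> real mat \<Rightarrow> bool" where
  "structurally_controllable n A B \<longleftrightarrow>
     (\<exists>A' \<in> carrier_mat n n. \<exists>B' \<in> carrier_mat n n.
        controllable n A' B' \<and> same_structure (A', B') (A, B))"

definition C_sets :: "nat \<Rightarrow> real mat \<Rightarrow> nat \<Rightarrow> nat set set" where
  "C_sets n A K =
     {S. S \<subseteq> {0..<n} \<and> card S = K \<and> structurally_controllable n A (input_mat n S)}"

definition R_sets :: "nat \<Rightarrow> real mat \<Rightarrow> nat \<Rightarrow> nat set set" where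
  "R_sets n A K = {R. R \<subseteq> {0..<n} \<and> {0..<n} - R \<in> C_sets n A K}"

definition R_tilde :: "nat \<Rightarrow> real mat \<Rightarrow> nat \<Rightarrow> nat set set" where
  "R_tilde n A K = {Q. \<exists>R \<in> R_sets n A K. Q \<subseteq> R}"

locale matroid =
  fixes ground :: "'a set" and indep :: "'a set set"
  assumes finite_ground: "finite ground"
    and indep_subset_ground: "X \<in> indep \<Longrightarrow> X \<subseteq> ground"
    and empty_indep: "{} \<in> indep"
    and indep_subset: "X \<in> indep \<Longrightarrow> Y \<subseteq> X \<Longrightarrow> Y \<in> indep"
    and indep_augment: "X \<in> indep \<Longrightarrow> Y \<in> indep \<Longrightarrow> card X < card Y \<Longrightarrow>
      \<exists>y \<in> Y - X. insert y X \<in> indep"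

end

theory Submission
  imports Defs "HOL-Combinatorics.Cycles"
begin

text \<open>
  Call a set \<open>R\<close> of rows of \<open>A\<close> matchable if its rows can be assigned distinct columns in which
  they have nonzero entries. Matchable sets satisfy the augmentation axiom, so the matchable sets
  that extend to one of size \<open>n - K\<close> form a matroid. The theorem therefore follows from a
  description of the actuated sets: for a strongly connected graph, \<open>(A, B(S))\<close> is structurally
  controllable exactly when \<open>S\<close> is nonempty and the rows outside \<open>S\<close> are matchable
  (\<open>structurally_controllable_iff_matchable\<close>, the strongly connected case of Lin's theorem).

  Controllability is used in its dual form: no nonzero row vector \<open>x\<close> satisfies
  \<open>x A^k B = 0\<close> for all \<open>k\<close>. For a diagonal \<open>B\<close> supported on \<open>S\<close> this says that a nonzero vector
  evolving under the transpose of \<open>A\<close> cannot stay invisible on \<open>S\<close> forever.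

  Necessity: a linear dependency among the rows of \<open>A\<close> outside \<open>S\<close> is an invisible vector, and
  linearly independent rows are matchable (\<open>independent_rows_imp_matchable\<close>).

  Sufficiency: a matching of the rows outside \<open>S\<close> splits the graph into paths that
  start in \<open>S\<close> and disjoint cycles. The paths alone are observable from \<open>S\<close>
  (\<open>observable_stems\<close>). The cycles are then attached one at a time: strong connectivity
  supplies an edge from the part already treated into a new cycle, and the enlarged system is again
  observable if the common weight of the edges of the cycle is large (\<open>observable_add_cycle\<close>). The
  reason is that an invisible vector must then be periodic up to scaling by the weight, so it drives
  the old part at complex frequencies whose modulus is the weight, far outside the spectrum of the
  old part; the response seen in \<open>S\<close> is then dominated by the first nonzero Markov parameter of the
  old part and cannot vanish. The
  resulting weights may be zero on some edges of \<open>A\<close>; since controllability is an open condition, a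
  small multiple of \<open>A\<close> can be added to obtain exactly the zero pattern of \<open>A\<close>
  (\<open>controllable_perturb_to_pattern\<close>).
\<close>

section \<open>Matchable sets of rows\<close>

definition matchable :: "('a \<Rightarrow> 'b \<Rightarrow> bool) \<Rightarrow> 'b set \<Rightarrow> 'a set \<Rightarrow> bool" where
  "matchable e J R \<longleftrightarrow> (\<exists>p. inj_on p R \<and> p ` R \<subseteq> J \<and> (\<forall>r\<in>R. e r (p r)))"

lemma matchable_mono:
  assumes "matchable e J R" and "Q \<subseteq> R"
  shows "matchable e J Q"
  using assms unfolding matchable_def by (meson image_mono inj_on_subset subsetD subset_trans)

text \<open>
  Among the matchings of \<open>X\<close>, one that agrees as often as possible with a fixed matching of
  \<open>Y\<close> cannot be blocked: a row of \<open>Y\<close> whose column is still free either lies outside \<open>X\<close>, and can be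
  added, or lies in \<open>X\<close> and can be reassigned to that column, which increases the agreement.
\<close>

lemma matchable_augment:
  assumes fin: "finite X" "finite Y"
    and X: "matchable e J X" and Y: "matchable e J Y" and less: "card X < card Y"
  shows "\<exists>y\<in>Y - X. matchable e J (insert y X)"
proof -
  obtain q where q: "inj_on q Y" "q ` Y \<subseteq> J" "\<And>r. r \<in> Y \<Longrightarrow> e r (q r)"
    using Y unfolding matchable_def by blast
  have "\<exists>y\<in>Y - X. matchable e J (insert y X)"
    if "inj_on p X" "p ` X \<subseteq> J" "\<forall>r\<in>X. e r (p r)" for p
    using that
  proof (induction "card {r \<in> X \<inter> Y. p r \<noteq> q r}" arbitrary: p rule: less_induct)
    case less
    have "card (p ` X) < card (q ` Y)"
      using assms less.prems(1) q(1) by (simp add: card_image)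
    then have "\<not> q ` Y \<subseteq> p ` X"
      using card_mono[of "p ` X" "q ` Y"] fin by (meson finite_imageI leD)
    then obtain y where y: "y \<in> Y" "q y \<notin> p ` X"
      by blast
    define p' where "p' = p(y := q y)"
    have p': "inj_on p' (insert y X)" "p' ` insert y X \<subseteq> J" "\<forall>r\<in>insert y X. e r (p' r)"
      using less.prems y q unfolding p'_def inj_on_def by (auto simp: image_iff)
    show ?case
    proof (cases "y \<in> X")
      case False
      then show ?thesis
        using p' y(1) unfolding matchable_def by blast
    next
      case True
      have "{r \<in> X \<inter> Y. p' r \<noteq> q r} \<subset> {r \<in> X \<inter> Y. p r \<noteq> q r}"
      proof (rule psubsetI)
        have "y \<in> {r \<in> X \<inter> Y. p r \<noteq> q r} - {r \<in> X \<inter> Y. p' r \<noteq> q r}"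
          using True y unfolding p'_def by force
        then show "{r \<in> X \<inter> Y. p' r \<noteq> q r} \<noteq> {r \<in> X \<inter> Y. p r \<noteq> q r}"
          by blast
      qed (auto simp: p'_def)
      then have "card {r \<in> X \<inter> Y. p' r \<noteq> q r} < card {r \<in> X \<inter> Y. p r \<noteq> q r}"
        using fin by (intro psubset_card_mono) auto
      then show ?thesis
        using less.hyps[of p'] p' True by (simp add: insert_absorb)
    qed
  qed
  then show ?thesis
    using X unfolding matchable_def by blast
qed

lemma matchable_extend:
  assumes "finite X" "finite Y" "matchable e J X" "matchable e J Y" "card X \<le> card Y"
  shows "\<exists>Z. X \<subseteq> Z \<and> Z \<subseteq> X \<union> Y \<and> card Z = card Y \<and> matchable e J Z"
  using assms
proof (induction "card Y - card X" arbitrary: X)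
  case 0
  then show ?case by (intro exI[of _ X]) auto
next
  case (Suc d)
  have "card X < card Y"
    using Suc.hyps(2) by linarith
  then obtain y where y: "y \<in> Y - X" "matchable e J (insert y X)"
    using matchable_augment[OF Suc.prems(1-4)] by blast
  have card: "card (insert y X) = Suc (card X)"
    using y Suc.prems(1) by simp
  obtain Z where "insert y X \<subseteq> Z" "Z \<subseteq> insert y X \<union> Y" "card Z = card Y" "matchable e J Z"
    using Suc.hyps(1)[of "insert y X"] Suc.hyps(2) Suc.prems(1,2,4) y(2) \<open>card X < card Y\<close>
    unfolding card by (metis Suc_leI diff_Suc_Suc diff_Suc_1 Suc_diff_Suc finite_insert nat.inject)
  then show ?case
    using y(1) by (intro exI[of _ Z]) auto
qed

text \<open>
  Induction on the number of rows. A row \<open>r0\<close> can be given column \<open>j\<close> if its entry there is nonzero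
  and the other rows stay independent after column \<open>j\<close> is deleted. If no \<open>j\<close> qualified, then for
  each nonzero entry of \<open>r0\<close> some combination of the other rows would be a multiple of the \<open>j\<close>th
  unit vector, and \<open>r0\<close> would be a combination of these.
\<close>

lemma independent_rows_imp_matchable:
  fixes a :: "'a \<Rightarrow> 'b \<Rightarrow> 'c::field"
  assumes "finite R" and "finite J"
    and "\<And>x. \<forall>j\<in>J. (\<Sum>r\<in>R. x r * a r j) = 0 \<Longrightarrow> \<forall>r\<in>R. x r = 0"
  shows "matchable (\<lambda>r j. a r j \<noteq> 0) J R"
  using assms
proof (induction R arbitrary: J rule: finite_induct)
  case empty
  then show ?case by (simp add: matchable_def)
next
  case (insert r0 R)
  show ?case
  proof (cases "\<exists>j\<in>J. a r0 j \<noteq> 0 \<and>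
      (\<forall>x. (\<forall>i\<in>J - {j}. (\<Sum>r\<in>R. x r * a r i) = 0) \<longrightarrow> (\<forall>r\<in>R. x r = 0))")
    case True
    then obtain j where j: "j \<in> J" "a r0 j \<noteq> 0" and
      indep: "\<And>x. \<forall>i\<in>J - {j}. (\<Sum>r\<in>R. x r * a r i) = 0 \<Longrightarrow> \<forall>r\<in>R. x r = 0"
      by blast
    have "matchable (\<lambda>r j. a r j \<noteq> 0) (J - {j}) R"
      using insert.IH[of "J - {j}"] insert.prems(1) indep by simp
    then obtain p where p: "inj_on p R" "p ` R \<subseteq> J - {j}" "\<forall>r\<in>R. a r (p r) \<noteq> 0"
      unfolding matchable_def by blast
    have eq: "(p(r0 := j)) ` R = p ` R"
      using insert.hyps(2) by auto
    have "inj_on (p(r0 := j)) R"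
      using p(1) insert.hyps(2) by (auto simp: inj_on_def)
    then have "inj_on (p(r0 := j)) (insert r0 R)"
      using p(2) insert.hyps(2) eq by auto
    then show ?thesis
      unfolding matchable_def using p j insert.hyps(2) by (intro exI[of _ "p(r0 := j)"]) auto
  next
    case False
    define K where "K = {j \<in> J. a r0 j \<noteq> 0}"
    have "\<forall>j\<in>K. \<exists>x. (\<forall>i\<in>J - {j}. (\<Sum>r\<in>R. x r * a r i) = 0) \<and> (\<exists>r\<in>R. x r \<noteq> 0)"
      using False unfolding K_def by blast
    then obtain x where x0: "\<And>j i. j \<in> K \<Longrightarrow> i \<in> J - {j} \<Longrightarrow> (\<Sum>r\<in>R. x j r * a r i) = 0"
      and xne: "\<And>j. j \<in> K \<Longrightarrow> \<exists>r\<in>R. x j r \<noteq> 0"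
      by metis
    define d where "d j = (\<Sum>r\<in>R. x j r * a r j)" for j
    have d: "d j \<noteq> 0" if "j \<in> K" for j
    proof
      assume "d j = 0"
      then have zero: "\<forall>i\<in>J. (\<Sum>r\<in>R. x j r * a r i) = 0"
        using x0[OF that] unfolding d_def by blast
      have "(\<Sum>r\<in>insert r0 R. ((x j)(r0 := 0)) r * a r i) = (\<Sum>r\<in>R. x j r * a r i)" for i
        using insert.hyps by (auto intro!: sum.cong)
      then have "\<forall>r\<in>insert r0 R. ((x j)(r0 := 0)) r = 0"
        using zero insert.prems(2)[of "(x j)(r0 := 0)"] by presburger
      then show False
        using xne[OF that] insert.hyps(2) by (metis fun_upd_apply insertCI)
    qed
    \<comment> \<open>row \<open>r0\<close> minus its expansion in the unit vectors supplied by the \<open>x j\<close>\<close>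
    define y where "y r = (if r = r0 then 1 else - (\<Sum>j\<in>K. a r0 j / d j * x j r))" for r
    have finK: "finite K"
      using insert.prems(1) unfolding K_def by simp
    have "(\<Sum>r\<in>insert r0 R. y r * a r i) = 0" if i: "i \<in> J" for i
    proof -
      have "(\<Sum>r\<in>R. y r * a r i) = (\<Sum>r\<in>R. - (\<Sum>j\<in>K. a r0 j / d j * (x j r * a r i)))"
        using insert.hyps(2) by (intro sum.cong) (auto simp: y_def sum_distrib_right mult.assoc)
      also have "\<dots> = - (\<Sum>j\<in>K. a r0 j / d j * (\<Sum>r\<in>R. x j r * a r i))"
        by (simp add: sum_negf sum_distrib_left sum.swap[of _ R])
      also have "(\<Sum>j\<in>K. a r0 j / d j * (\<Sum>r\<in>R. x j r * a r i)) =
          (\<Sum>j\<in>K. if j = i then a r0 i else 0)"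
        using x0 i d by (intro sum.cong) (auto simp: d_def)
      also have "\<dots> = a r0 i"
        using finK i by (auto simp: K_def)
      finally show ?thesis
        using insert.hyps by (simp add: y_def)
    qed
    then have "y r0 = 0"
      using insert.prems(2)[of y] by blast
    then show ?thesis
      by (simp add: y_def)
  qed
qed


section \<open>Observability of a weighted digraph\<close>

text \<open>
  The action of the transpose of the matrix \<open>a\<close> on vectors indexed by \<open>U\<close>. The value at an index
  outside \<open>U\<close> is never fed back, so that an operator on a subset \<open>U\<close> can be compared with
  one on a larger set without restricting vectors.
\<close>

definition adjoint_op :: "'a set \<Rightarrow> ('a \<Rightarrow> 'a \<Rightarrow> real) \<Rightarrow> ('a \<Rightarrow> real) \<Rightarrow> 'a \<Rightarrow> real" where
  "adjoint_op U a x = (\<lambda>j. \<Sum>i\<in>U. a i j * x i)"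

definition unobservable :: "'a set \<Rightarrow> ('a \<Rightarrow> 'a \<Rightarrow> real) \<Rightarrow> 'a set \<Rightarrow> ('a \<Rightarrow> real) \<Rightarrow> bool" where
  "unobservable U a S x \<longleftrightarrow> (\<forall>k. \<forall>s\<in>S. (adjoint_op U a ^^ k) x s = 0)"

definition observable :: "'a set \<Rightarrow> ('a \<Rightarrow> 'a \<Rightarrow> real) \<Rightarrow> 'a set \<Rightarrow> bool" where
  "observable U a S \<longleftrightarrow> (\<forall>x. unobservable U a S x \<longrightarrow> (\<forall>i\<in>U. x i = 0))"

lemma adjoint_op_lincomb:
  "adjoint_op U a (\<lambda>i. b * x i + c * y i) = (\<lambda>j. b * adjoint_op U a x j + c * adjoint_op U a y j)"
  unfolding adjoint_op_def sum_distrib_left sum.distrib[symmetric]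
  by (simp add: distrib_left mult.left_commute)

lemma adjoint_op_funpow_lincomb:
  "(adjoint_op U a ^^ k) (\<lambda>i. b * x i + c * y i) =
    (\<lambda>j. b * (adjoint_op U a ^^ k) x j + c * (adjoint_op U a ^^ k) y j)"
  by (induction k) (simp_all add: adjoint_op_lincomb)

lemma adjoint_op_funpow_cong:
  assumes "\<And>i. i \<in> U \<Longrightarrow> x i = y i" and "j \<in> U"
  shows "(adjoint_op U a ^^ k) x j = (adjoint_op U a ^^ k) y j"
  using assms(2)
proof (induction k arbitrary: j)
  case 0
  then show ?case using assms(1) by simp
next
  case (Suc k)
  then show ?case by (simp add: adjoint_op_def)
qed

lemma unobservable_adjoint_op:
  assumes "unobservable U a S x"
  shows "unobservable U a S (adjoint_op U a x)"
  using assms unfolding unobservable_def by (metis comp_apply funpow_Suc_right)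

lemma unobservable_funpow:
  assumes "unobservable U a S x"
  shows "unobservable U a S ((adjoint_op U a ^^ m) x)"
  using assms by (induction m) (simp_all add: unobservable_adjoint_op)

text \<open>
  The operator norm for the sum norm is bounded by the sum of all entries; a crude bound suffices
  because the weights of the cycles may be chosen as large as desired.
\<close>

lemma adjoint_op_funpow_norm:
  fixes a :: "'a \<Rightarrow> 'a \<Rightarrow> real"
  assumes "finite U"
  shows "(\<Sum>j\<in>U. \<bar>(adjoint_op U a ^^ k) x j\<bar>) \<le> (\<Sum>i\<in>U. \<Sum>j\<in>U. \<bar>a i j\<bar>) ^ k * (\<Sum>i\<in>U. \<bar>x i\<bar>)"
proof (induction k)
  case 0
  then show ?case by simp
next
  case (Suc k)
  let ?y = "(adjoint_op U a ^^ k) x"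
  have "(\<Sum>j\<in>U. \<bar>adjoint_op U a ?y j\<bar>) \<le> (\<Sum>j\<in>U. \<Sum>i\<in>U. \<bar>a i j\<bar> * \<bar>?y i\<bar>)"
    unfolding adjoint_op_def by (intro sum_mono order_trans[OF sum_abs]) (simp add: abs_mult)
  also have "\<dots> = (\<Sum>i\<in>U. (\<Sum>j\<in>U. \<bar>a i j\<bar>) * \<bar>?y i\<bar>)"
    by (subst sum.swap) (simp add: sum_distrib_right)
  also have "\<dots> \<le> (\<Sum>i\<in>U. (\<Sum>i\<in>U. \<Sum>j\<in>U. \<bar>a i j\<bar>) * \<bar>?y i\<bar>)"
    using assms by (intro sum_mono mult_right_mono member_le_sum) (auto intro: sum_nonneg)
  also have "\<dots> = (\<Sum>i\<in>U. \<Sum>j\<in>U. \<bar>a i j\<bar>) * (\<Sum>i\<in>U. \<bar>?y i\<bar>)"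
    by (simp add: sum_distrib_left)
  also have "\<dots> \<le> (\<Sum>i\<in>U. \<Sum>j\<in>U. \<bar>a i j\<bar>) * ((\<Sum>i\<in>U. \<Sum>j\<in>U. \<bar>a i j\<bar>) ^ k * (\<Sum>i\<in>U. \<bar>x i\<bar>))"
    by (intro mult_left_mono Suc.IH) (auto intro: sum_nonneg)
  finally show ?case
    by (simp add: mult.assoc)
qed

section \<open>Observable weights on paths and cycles\<close>

text \<open>
  The common weight \<open>w\<close> on the cycle makes the dynamics on \<open>C\<close> a rotation followed by scaling, so
  that \<open>k\<close> steps multiply the part of an invisible vector on \<open>C\<close> by \<open>w^k\<close>. As \<open>U\<close> was observable,
  an invisible vector that vanishes on \<open>C\<close> is zero; applied to \<open>T'^k x - w^k x\<close>, this makes the whole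
  trajectory periodic after division by \<open>w^m\<close>. Let \<open>Y\<close> and \<open>F\<close> be the sums over
  one period of the sizes of the state on \<open>U\<close> and of the signal that enters \<open>U\<close> through the edge from
  \<open>u\<close> to \<open>c\<close> (the transposed system runs against the edges). Periodicity gives
  \<open>w Y \<le> \<alpha> Y + F\<close>, whereas invisibility on \<open>S\<close> bounds the signal by the state,
  \<open>d F \<le> \<alpha>^(l+1) Y\<close>. For large \<open>w\<close> both hold only if \<open>Y\<close> and \<open>F\<close> are zero.
\<close>

lemma observable_add_cycle:
  fixes a :: "'a \<Rightarrow> 'a \<Rightarrow> real" and q :: "'a \<Rightarrow> 'a"
  assumes fin: "finite U" "finite C" and disj: "C \<inter> U = {}"
    and SU: "S \<subseteq> U" and u: "u \<in> U" and obs: "observable U a S"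
    and C: "C = range (\<lambda>m. (q ^^ m) c)" and k: "0 < k" "q ^^ k = id"
  shows "\<exists>a'. observable (U \<union> C) a' S \<and>
    (\<forall>i j. a' i j \<noteq> 0 \<longrightarrow> i \<in> U \<and> j \<in> U \<and> a i j \<noteq> 0 \<or> i = c \<and> j = u \<or> i \<in> C \<and> j = q i)"
proof -
  let ?T = "adjoint_op U a"
  define e where "e i = (if i = u then 1 else 0 :: real)" for i
  have c: "c \<in> C"
    unfolding C by (metis funpow_0 rangeI)
  have qC: "q r \<in> C" if r: "r \<in> C" for r
  proof -
    obtain m where "r = (q ^^ m) c"
      using r C by blast
    then have "q r = (q ^^ Suc m) c"
      by simp
    then show ?thesis
      unfolding C by blast
  qed
  have qk: "(q ^^ k) r = r" for r
    using k(2) by simp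
  have inj: "r = r'" if "q r = q r'" for r r'
  proof -
    obtain k' where "k = Suc k'"
      using k(1) gr0_implies_Suc by blast
    then have "(q ^^ k) r = (q ^^ k) r'"
      using that by (simp add: funpow_Suc_right del: funpow.simps)
    then show ?thesis by (simp add: qk)
  qed
  have reach: "\<exists>m. (q ^^ m) r = c" if r: "r \<in> C" for r
  proof -
    obtain i where i: "r = (q ^^ i) c"
      using r C by blast
    have "(q ^^ ((k - 1) * i)) r = (q ^^ ((k - 1) * i + i)) c"
      by (simp add: i funpow_add)
    also have "(k - 1) * i + i = k * i"
      using k(1) by (cases k) auto
    also have "(q ^^ (k * i)) c = c"
      using k(2) by (simp add: funpow_mult[symmetric])
    finally show ?thesis by blast
  qed
  have "\<not> unobservable U a S e"
  proof
    assume "unobservable U a S e"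
    then have "e u = 0"
      using obs u unfolding observable_def by blast
    then show False by (simp add: e_def)
  qed
  then have ex: "\<exists>l. \<exists>s\<in>S. (?T ^^ l) e s \<noteq> 0"
    unfolding unobservable_def by blast
  \<comment> \<open>the first time at which an impulse at \<open>u\<close> becomes visible\<close>
  define l where "l = (LEAST l. \<exists>s\<in>S. (?T ^^ l) e s \<noteq> 0)"
  obtain s where s: "s \<in> S" "(?T ^^ l) e s \<noteq> 0"
    using LeastI_ex[OF ex] unfolding l_def by blast
  have lmin: "(?T ^^ i) e s' = 0" if "i < l" "s' \<in> S" for i s'
    using not_less_Least[of i "\<lambda>l. \<exists>s\<in>S. (?T ^^ l) e s \<noteq> 0"] that unfolding l_def by blast
  define d where "d = \<bar>(?T ^^ l) e s\<bar>"
  have d: "d > 0"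
    using s by (simp add: d_def)
  define \<alpha> where "\<alpha> = (\<Sum>i\<in>U. \<Sum>j\<in>U. \<bar>a i j\<bar>)"
  have \<alpha>: "\<alpha> \<ge> 0"
    unfolding \<alpha>_def by (intro sum_nonneg) simp
  \<comment> \<open>any weight above \<open>\<alpha> + \<alpha>^(l+1) / d\<close> separates the two inequalities between \<open>Y\<close> and \<open>F\<close>\<close>
  define w where "w = \<alpha> + \<alpha> ^ (l + 1) / d + 1"
  have w: "w > 0"
  proof -
    have "0 \<le> \<alpha> ^ (l + 1) / d"
      using \<alpha> d by simp
    then show ?thesis
      using \<alpha> unfolding w_def by linarith
  qed
  define a' where "a' i j = (if i \<in> U \<and> j \<in> U then a i j else if i = c \<and> j = u then 1
    else if i \<in> C \<and> j = q i then w else 0)" for i j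
  let ?T' = "adjoint_op (U \<union> C) a'"
  have T'C: "?T' x (q r) = w * x r" if "r \<in> C" for x r
  proof -
    have qr: "q r \<notin> U" "q r \<noteq> u"
      using qC[OF that] disj u by auto
    have "?T' x (q r) = (\<Sum>i\<in>U \<union> C. if i = r then w * x r else 0)"
      unfolding adjoint_op_def
      using qr disj that inj by (intro sum.cong) (auto simp: a'_def)
    also have "\<dots> = w * x r"
      using that fin by simp
    finally show ?thesis .
  qed
  have T'U: "?T' x j = ?T x j + x c * e j" if "j \<in> U" for x j
  proof -
    have "j \<notin> C" using that disj by blast
    have "?T' x j = (\<Sum>i\<in>U. a' i j * x i) + (\<Sum>i\<in>C. a' i j * x i)"
      unfolding adjoint_op_def using fin disj by (intro sum.union_disjoint) auto
    also have "(\<Sum>i\<in>U. a' i j * x i) = ?T x j"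
      unfolding adjoint_op_def using that by (simp add: a'_def)
    also have "(\<Sum>i\<in>C. a' i j * x i) = (\<Sum>i\<in>C. if i = c then x c * e j else 0)"
    proof (rule sum.cong[OF refl])
      fix i assume i: "i \<in> C"
      then have "i \<notin> U" "j \<noteq> q i"
        using disj \<open>j \<notin> C\<close> qC by auto
      then show "a' i j * x i = (if i = c then x c * e j else 0)"
        by (auto simp: a'_def e_def)
    qed
    also have "\<dots> = x c * e j"
      using c fin by simp
    finally show ?thesis .
  qed
  have iterC: "(?T' ^^ m) x ((q ^^ m) r) = w ^ m * x r" if "r \<in> C" for m x r
  proof (induction m)
    case (Suc m)
    have "(q ^^ m) r \<in> C"
      using that qC by (induction m) auto
    then show ?case
      using Suc T'C by simp
  qed simp
  have silent: "\<forall>i\<in>U. x i = 0" if un: "unobservable (U \<union> C) a' S x" and xC: "\<forall>r\<in>C. x r = 0" for x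
  proof -
    have *: "(\<forall>r\<in>C. (?T' ^^ m) x r = 0) \<and> (\<forall>j\<in>U. (?T' ^^ m) x j = (?T ^^ m) x j)" for m
    proof (induction m)
      case (Suc m)
      have "(?T' ^^ Suc m) x r = 0" if r: "r \<in> C" for r
      proof -
        have "(?T' ^^ Suc m) x ((q ^^ Suc m) r') = 0" if "r' \<in> C" for r'
          using iterC[OF that, of "Suc m" x] xC that by (simp del: funpow.simps)
        moreover obtain r' where "r' \<in> C" "(q ^^ Suc m) r' = r"
        proof -
          \<comment> \<open>\<open>(k - 1) (m + 1)\<close> further steps complete a whole number of periods\<close>
          have "(q ^^ Suc m) ((q ^^ ((k - 1) * Suc m)) r) = (q ^^ (Suc m + (k - 1) * Suc m)) r"
            by (simp add: funpow_add)
          also have "Suc m + (k - 1) * Suc m = k * Suc m"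
            using k(1) by (cases k) auto
          also have "(q ^^ (k * Suc m)) r = r"
            using k(2) by (simp add: funpow_mult[symmetric] del: mult_Suc_right)
          finally have "(q ^^ Suc m) ((q ^^ ((k - 1) * Suc m)) r) = r" .
          moreover have "(q ^^ i) r \<in> C" for i
            using r qC by (induction i) auto
          ultimately show ?thesis using that by blast
        qed
        ultimately show ?thesis by metis
      qed
      moreover have "(?T' ^^ Suc m) x j = (?T ^^ Suc m) x j" if "j \<in> U" for j
      proof -
        have "?T' ((?T' ^^ m) x) j = ?T ((?T' ^^ m) x) j"
          using T'U[OF that, of "(?T' ^^ m) x"] Suc.IH c by simp
        also have "\<dots> = ?T ((?T ^^ m) x) j"
          unfolding adjoint_op_def[of U a "(?T' ^^ m) x"] adjoint_op_def[of U a "(?T ^^ m) x"]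
          using Suc.IH by (intro sum.cong) auto
        finally show ?thesis by simp
      qed
      ultimately show ?case by blast
    qed (use xC in simp)
    have "unobservable U a S x"
      using un * SU unfolding unobservable_def by (metis subsetD)
    then show ?thesis
      using obs unfolding observable_def by blast
  qed
  have periodic: "(?T' ^^ k) x j = w ^ k * x j"
    if un: "unobservable (U \<union> C) a' S x" and j: "j \<in> U \<union> C" for x j
  proof -
    define y where "y i = 1 * (?T' ^^ k) x i + (- (w ^ k)) * x i" for i
    have yC: "\<forall>r\<in>C. y r = 0"
      using iterC[of _ k x] qk by (simp add: y_def)
    have "unobservable (U \<union> C) a' S y"
      using un unobservable_funpow[OF un, of k]
      unfolding unobservable_def y_def adjoint_op_funpow_lincomb by simp
    then have "y j = 0"
      using silent yC j by blast
    then show ?thesis by (simp add: y_def)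
  qed
  define N where "N x = (\<Sum>i\<in>U. \<bar>x i\<bar>)" for x :: "'a \<Rightarrow> real"
  have response: "d * \<bar>x c\<bar> \<le> \<alpha> ^ (l + 1) * N x" if un: "unobservable (U \<union> C) a' S x" for x
  proof -
    have step: "(?T ^^ Suc i) x j = (?T ^^ i) (?T' x) j - x c * (?T ^^ i) e j"
      if "j \<in> U" for i j x
    proof -
      have "(?T ^^ Suc i) x j = (?T ^^ i) (?T x) j"
        by (simp add: funpow_swap1)
      also have "\<dots> = (?T ^^ i) (\<lambda>j. 1 * ?T' x j + (- x c) * e j) j"
        using that T'U by (intro adjoint_op_funpow_cong) auto
      also have "\<dots> = (?T ^^ i) (?T' x) j - x c * (?T ^^ i) e j"
        unfolding adjoint_op_funpow_lincomb by simp
      finally show ?thesis .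
    qed
    \<comment> \<open>an impulse at \<open>u\<close> needs \<open>l\<close> steps to be seen, so up to time \<open>l\<close> the old system shows on \<open>S\<close>
      what the new one shows, which is nothing; at time \<open>l + 1\<close> the difference is a single impulse\<close>
    have zero: "(?T ^^ i) x s' = 0" if "i \<le> l" "s' \<in> S" "unobservable (U \<union> C) a' S x" for i s' x
      using that
    proof (induction i arbitrary: x)
      case 0
      then show ?case unfolding unobservable_def by (metis funpow_0)
    next
      case (Suc i)
      then show ?case
        using step[of s' i x] lmin[of i s'] unobservable_adjoint_op SU by fastforce
    qed
    have "(?T ^^ Suc l) x s = - x c * (?T ^^ l) e s"
      using step[of s l x] zero[of l s] s unobservable_adjoint_op[OF un] SU by auto
    then have "d * \<bar>x c\<bar> = \<bar>(?T ^^ Suc l) x s\<bar>"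
      by (simp add: d_def abs_mult)
    also have "\<dots> \<le> (\<Sum>j\<in>U. \<bar>(?T ^^ Suc l) x j\<bar>)"
      using s SU fin by (intro member_le_sum) auto
    also have "\<dots> \<le> \<alpha> ^ (l + 1) * N x"
      using adjoint_op_funpow_norm[OF fin(1), of "Suc l" a x] by (simp add: \<alpha>_def N_def)
    finally show ?thesis .
  qed
  have "observable (U \<union> C) a' S"
    unfolding observable_def
  proof (intro allI impI)
    fix x assume un: "unobservable (U \<union> C) a' S x"
    define v where "v m i = (?T' ^^ m) x i / w ^ m" for m i
    have un_z: "unobservable (U \<union> C) a' S ((?T' ^^ m) x)" for m
      using unobservable_funpow[OF un] .
    have per: "v k i = v 0 i" if "i \<in> U" for i
      using periodic[OF un, of i] that w by (simp add: v_def)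
    have Nv: "N (v m) = N ((?T' ^^ m) x) / w ^ m" for m
      using w by (simp add: N_def v_def sum_divide_distrib)
    have driven: "w * N (v (Suc m)) \<le> \<alpha> * N (v m) + \<bar>v m c\<bar>" for m
    proof -
      let ?z = "(?T' ^^ m) x"
      have "N ((?T' ^^ Suc m) x) \<le> (\<Sum>j\<in>U. \<bar>?T ?z j\<bar> + \<bar>?z c * e j\<bar>)"
        unfolding N_def using T'U[of _ ?z] by (intro sum_mono) (simp add: abs_triangle_ineq)
      also have "\<dots> = (\<Sum>j\<in>U. \<bar>?T ?z j\<bar>) + (\<Sum>j\<in>U. if j = u then \<bar>?z c\<bar> else 0)"
        unfolding sum.distrib by (intro arg_cong2[where f = "(+)"] sum.cong) (auto simp: e_def)
      also have "\<dots> \<le> \<alpha> * N ?z + \<bar>?z c\<bar>"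
        using adjoint_op_funpow_norm[OF fin(1), of 1 a ?z] u fin by (simp add: \<alpha>_def N_def)
      finally have "N ((?T' ^^ Suc m) x) / w ^ m \<le> (\<alpha> * N ?z + \<bar>?z c\<bar>) / w ^ m"
        using w by (intro divide_right_mono) auto
      then show ?thesis
        using w unfolding Nv by (simp add: v_def add_divide_distrib)
    qed
    have out: "d * \<bar>v m c\<bar> \<le> \<alpha> ^ (l + 1) * N (v m)" for m
      using divide_right_mono[OF response[OF un_z[of m]], of "w ^ m"] w unfolding Nv
      by (simp add: v_def)
    define Y where "Y = (\<Sum>m<k. N (v m))"
    define F where "F = (\<Sum>m<k. \<bar>v m c\<bar>)"
    have Y0: "Y \<ge> 0"
      unfolding Y_def N_def by (intro sum_nonneg) simp
    have "N (v k) = N (v 0)"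
      unfolding N_def using per by (intro sum.cong) auto
    then have "(\<Sum>m<k. N (v (Suc m))) = Y"
      using sum.lessThan_Suc_shift[of "\<lambda>m. N (v m)" k] unfolding Y_def by simp
    then have 1: "w * Y \<le> \<alpha> * Y + F"
      using sum_mono[OF driven, of "\<lambda>m. m" "{..<k}"]
      by (simp add: sum_distrib_left[symmetric] sum.distrib Y_def F_def)
    have 2: "d * F \<le> \<alpha> ^ (l + 1) * Y"
      using sum_mono[OF out, of "\<lambda>m. m" "{..<k}"] by (simp add: sum_distrib_left[symmetric] Y_def F_def)
    have "d * (w * Y) \<le> d * (\<alpha> * Y) + \<alpha> ^ (l + 1) * Y"
      using mult_left_mono[OF 1, of d] d 2 by (simp add: distrib_left)
    moreover have "d * (w * Y) = d * (\<alpha> * Y) + \<alpha> ^ (l + 1) * Y + d * Y"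
      using d unfolding w_def by (simp add: field_simps)
    ultimately have "d * Y \<le> 0"
      by linarith
    then have Y: "Y = 0"
      using d Y0 by (simp add: mult_le_0_iff)
    have vc: "v m c = 0" if "m < k" for m
    proof -
      have "F \<le> 0"
        using 2 d Y by (simp add: mult_le_0_iff)
      then have "F = 0"
        unfolding F_def by (intro antisym sum_nonneg) auto
      then show ?thesis
        using that unfolding F_def by (simp add: sum_nonneg_eq_0_iff)
    qed
    have xC: "\<forall>r\<in>C. x r = 0"
    proof
      fix r assume r: "r \<in> C"
      obtain m where "(q ^^ m) r = c"
        using reach[OF r] by blast
      then have "(q ^^ (m mod k)) r = c"
        using funpow_mod_eq[OF qk] by metis
      then have "v (m mod k) c = x r"
        using iterC[OF r, of "m mod k" x] w by (simp add: v_def)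
      then show "x r = 0"
        using vc[of "m mod k"] k(1) by simp
    qed
    then show "\<forall>i\<in>U \<union> C. x i = 0"
      using silent[OF un] by blast
  qed
  moreover have "\<forall>i j. a' i j \<noteq> 0 \<longrightarrow>
      i \<in> U \<and> j \<in> U \<and> a i j \<noteq> 0 \<or> i = c \<and> j = u \<or> i \<in> C \<and> j = q i"
    unfolding a'_def by presburger
  ultimately show ?thesis by blast
qed

text \<open>
  Following \<open>p\<close> from \<open>v\<close> leads into \<open>S\<close>, and one step of the transposed dynamics moves the value at
  a vertex unchanged to its \<open>p\<close>-image. The initial value at \<open>v\<close> is therefore seen in \<open>S\<close> later. The
  map \<open>p\<close> is frozen on \<open>S\<close> because its values there are arbitrary.
\<close>

lemma observable_stems:
  fixes p :: "'a \<Rightarrow> 'a"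
  assumes "finite U" and "S \<subseteq> U" and inj: "inj_on p (U - S)" and maps: "p ` (U - S) \<subseteq> U"
    and reach: "\<And>v. v \<in> U \<Longrightarrow> \<exists>m. ((\<lambda>i. if i \<in> S then i else p i) ^^ m) v \<in> S"
  shows "observable U (\<lambda>i j. if i \<in> U - S \<and> j = p i then 1 else 0) S"
proof -
  let ?T = "adjoint_op U (\<lambda>i j. if i \<in> U - S \<and> j = p i then 1 else 0)"
  let ?p = "\<lambda>i. if i \<in> S then i else p i"
  have T: "?T x (p r) = x r" if "r \<in> U - S" for x r
  proof -
    have "?T x (p r) = (\<Sum>i\<in>U. if i = r then x r else 0)"
      unfolding adjoint_op_def using that inj by (intro sum.cong) (auto dest: inj_onD)
    also have "\<dots> = x r"
      using that assms(1) by simp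
    finally show ?thesis .
  qed
  have "x v = 0" if "(?p ^^ m) v \<in> S" "v \<in> U" "\<And>k s. s \<in> S \<Longrightarrow> (?T ^^ k) x s = 0" for m v x
    using that
  proof (induction m arbitrary: v x)
    case 0
    show ?case using "0.prems"(1) "0.prems"(3)[of v 0] by simp
  next
    case (Suc m)
    show ?case
    proof (cases "v \<in> S")
      case True
      then show ?thesis using Suc.prems(3)[of v 0] by simp
    next
      case False
      have "(?T ^^ k) (?T x) s = 0" if "s \<in> S" for k s
        using Suc.prems(3)[OF that, of "Suc k"] by (simp add: funpow_swap1)
      moreover have "(?p ^^ m) (p v) \<in> S"
        using Suc.prems(1) False by (simp add: funpow_Suc_right del: funpow.simps)
      moreover have "p v \<in> U"
        using False Suc.prems(2) maps by blast
      ultimately have "?T x (p v) = 0"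
        using Suc.IH[of "p v" "?T x"] by blast
      then show ?thesis
        using T[of v x] False Suc.prems(2) by simp
    qed
  qed
  then show ?thesis
    using reach unfolding observable_def unobservable_def by blast
qed

text \<open>
  The sets that carry observable weights and whose complement is mapped into itself by the matching
  include the union of the paths that start in \<open>S\<close>. On the complement of such a set the matching
  is a permutation, so any vertex of the complement that is entered by an edge lies on a cycle that
  can be added. A maximal such set is therefore everything.
\<close>

lemma structural_observability:
  fixes e :: "'a \<Rightarrow> 'a \<Rightarrow> bool"
  assumes fin: "finite V" and SV: "S \<subseteq> V" and match: "matchable e V (V - S)"
    and cut: "\<And>U. S \<subseteq> U \<Longrightarrow> U \<subset> V \<Longrightarrow> \<exists>u\<in>U. \<exists>c\<in>V - U. e c u"
  shows "\<exists>a. observable V a S \<and> (\<forall>i\<in>V. \<forall>j\<in>V. a i j \<noteq> 0 \<longrightarrow> e i j)"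
proof -
  obtain p where p: "inj_on p (V - S)" "p ` (V - S) \<subseteq> V" "\<And>i. i \<in> V - S \<Longrightarrow> e i (p i)"
    using match unfolding matchable_def by blast
  define good where "good U \<longleftrightarrow> S \<subseteq> U \<and> U \<subseteq> V \<and> p ` (V - U) \<subseteq> V - U \<and>
    (\<exists>a. observable U a S \<and> (\<forall>i\<in>U. \<forall>j\<in>U. a i j \<noteq> 0 \<longrightarrow> e i j))" for U
  have base: "\<exists>U. good U"
  proof -
    let ?p = "\<lambda>i. if i \<in> S then i else p i"
    define U where "U = {v \<in> V. \<exists>m. (?p ^^ m) v \<in> S}"
    have SU: "S \<subseteq> U"
      using SV unfolding U_def by (auto intro: exI[of _ 0])
    have UV: "U \<subseteq> V"
      unfolding U_def by blast
    have inU: "p v \<in> U" if "v \<in> U - S" for v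
    proof -
      obtain m where m: "(?p ^^ m) v \<in> S"
        using \<open>v \<in> U - S\<close> unfolding U_def by blast
      obtain m' where "m = Suc m'"
        using m \<open>v \<in> U - S\<close> by (cases m) auto
      then have "(?p ^^ m') (p v) \<in> S"
        using m \<open>v \<in> U - S\<close> by (simp add: funpow_Suc_right del: funpow.simps)
      moreover have "p v \<in> V"
        using \<open>v \<in> U - S\<close> UV p(2) by blast
      ultimately show ?thesis
        unfolding U_def by blast
    qed
    have notU: "p v \<in> V - U" if "v \<in> V - U" for v
    proof -
      have v: "v \<in> V - S"
        using \<open>v \<in> V - U\<close> SU by blast
      have "p v \<notin> U"
      proof
        assume "p v \<in> U"
        then obtain m where "(?p ^^ m) (p v) \<in> S"
          unfolding U_def by blast
        then have "(?p ^^ Suc m) v \<in> S"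
          using v by (simp add: funpow_Suc_right del: funpow.simps)
        then show False
          using \<open>v \<in> V - U\<close> unfolding U_def by blast
      qed
      then show ?thesis
        using v p(2) by blast
    qed
    have "observable U (\<lambda>i j. if i \<in> U - S \<and> j = p i then 1 else 0) S"
    proof (rule observable_stems)
      show "finite U" using UV fin by (rule finite_subset)
      show "inj_on p (U - S)" using p(1) by (rule inj_on_subset) (use UV in blast)
      show "\<exists>m. (?p ^^ m) v \<in> S" if "v \<in> U" for v
        using that unfolding U_def by blast
    qed (use SU inU in auto)
    moreover have "\<forall>i\<in>U. \<forall>j\<in>U. (if i \<in> U - S \<and> j = p i then 1 else 0 :: real) \<noteq> 0 \<longrightarrow> e i j"
      using p(3) UV by auto
    ultimately have "good U"
      unfolding good_def using SU UV notU by blast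
    then show ?thesis by blast
  qed
  have extend: "\<exists>U'. good U' \<and> U \<subset> U'" if "good U" "U \<noteq> V" for U
  proof -
    have U: "S \<subseteq> U" "U \<subseteq> V" "p ` (V - U) \<subseteq> V - U" and finU: "finite U"
      using \<open>good U\<close> fin finite_subset unfolding good_def by blast+
    obtain a where a: "observable U a S" "\<forall>i\<in>U. \<forall>j\<in>U. a i j \<noteq> 0 \<longrightarrow> e i j"
      using \<open>good U\<close> unfolding good_def by blast
    obtain u c where uc: "u \<in> U" "c \<in> V - U" "e c u"
      using cut[of U] U \<open>U \<noteq> V\<close> by blast
    \<comment> \<open>extended by the identity, the matching becomes a permutation of finite order\<close>
    define q where "q i = (if i \<in> V - U then p i else i)" for i
    have "inj_on p (V - U)"
      using p(1) by (rule inj_on_subset) (use U(1) in blast)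
    then have "bij_betw p (V - U) (V - U)"
      using endo_inj_surj[of "V - U" p] fin U(3) by (simp add: bij_betw_def)
    then have "bij_betw q (V - U) (V - U)"
      by (rule bij_betw_cong[THEN iffD1, rotated]) (simp add: q_def)
    then have "q permutes (V - U)"
      by (rule bij_imp_permutes) (auto simp: q_def)
    then have "permutation q"
      using fin unfolding permutation_permutes by blast
    then obtain k where k: "q ^^ k = id" "0 < k"
      by (rule permutation_is_nilpotent)
    define C where "C = range (\<lambda>m. (q ^^ m) c)"
    have "(q ^^ m) c \<in> V - U" for m
      using uc(2) U(3) by (induction m) (auto simp: q_def)
    then have CV: "C \<subseteq> V - U"
      unfolding C_def by blast
    have cC: "c \<in> C"
      unfolding C_def by (metis funpow_0 rangeI)
    have "finite C" "C \<inter> U = {}"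
      using CV fin finite_subset by blast+
    then obtain a' where a': "observable (U \<union> C) a' S"
      "\<And>i j. a' i j \<noteq> 0 \<Longrightarrow> i \<in> U \<and> j \<in> U \<and> a i j \<noteq> 0 \<or> i = c \<and> j = u \<or> i \<in> C \<and> j = q i"
      using observable_add_cycle[OF finU _ _ U(1) uc(1) a(1) C_def k(2,1)] by blast
    have "e i j" if "a' i j \<noteq> 0" for i j
      using a'(2)[OF that]
    proof (elim disjE conjE)
      assume "i \<in> C" "j = q i"
      then show "e i j"
        using CV U(1) p(3)[of i] by (auto simp: q_def)
    qed (use a(2) uc(3) in auto)
    moreover have "p r \<in> V - (U \<union> C)" if "r \<in> V - (U \<union> C)" for r
    proof -
      have "p r \<notin> C"
      proof
        assume "p r \<in> C"
        then obtain m where m: "q r = (q ^^ m) c"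
          using \<open>r \<in> V - (U \<union> C)\<close> unfolding C_def q_def by auto
        obtain k' where "k = Suc k'"
          using k(2) gr0_implies_Suc by blast
        then have "r = (q ^^ k') (q r)"
          using k(1) by (metis comp_apply funpow_Suc_right id_apply)
        also have "\<dots> = (q ^^ (k' + m)) c"
          by (simp add: m funpow_add)
        finally have "r \<in> C"
          unfolding C_def by blast
        then show False
          using \<open>r \<in> V - (U \<union> C)\<close> by blast
      qed
      then show ?thesis
        using \<open>r \<in> V - (U \<union> C)\<close> U(3) by blast
    qed
    ultimately have "good (U \<union> C)"
      unfolding good_def using U(1,2) CV a'(1) by blast
    moreover have "U \<subset> U \<union> C"
      using cC uc(2) by blast
    ultimately show ?thesis by blast
  qed
  have "finite {U. good U}"
    using fin by (rule finite_subset[rotated, OF finite_Pow_iff[THEN iffD2]]) (auto simp: good_def)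
  then obtain U where "good U" "\<And>U'. good U' \<Longrightarrow> U \<subseteq> U' \<Longrightarrow> U = U'"
    using base finite_has_maximal[of "{U. good U}"] by auto
  then have "good V"
    using extend by blast
  then show ?thesis
    unfolding good_def by blast
qed

section \<open>Matrices of full row rank\<close>

lemma (in vec_space) rank_eq_dim_iff_span:
  assumes "A \<in> carrier_mat n nc"
  shows "rank A = n \<longleftrightarrow> span (set (cols A)) = carrier_vec n"
proof -
  have cols: "set (cols A) \<subseteq> carrier_vec n"
    using cols_dim assms by blast
  show ?thesis
  proof
    assume rank: "rank A = n"
    obtain U where U: "maximal U (\<lambda>T. T \<subseteq> set (cols A) \<and> lin_indpt T)" "finite U"
      using maximal_exists_superset[of "set (cols A)" "\<lambda>T. T \<subseteq> set (cols A) \<and> lin_indpt T" "{}"]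
        finite_lin_indpt2[of "{}"] by auto
    have indep: "U \<subseteq> set (cols A)" "lin_indpt U"
      using U(1) unfolding maximal_def by blast+
    have "card U = n"
      using rank_card_indpt[OF assms U(1)] rank by simp
    then have "basis U"
      using dim_li_is_basis[OF fin_dim U(2)] indep cols by (auto simp: dim_is_n)
    then have "span U = carrier_vec n"
      unfolding basis_def by simp
    then show "span (set (cols A)) = carrier_vec n"
      using span_is_monotone[OF indep(1)] span_closed[OF cols] by auto
  next
    assume "span (set (cols A)) = carrier_vec n"
    then have "span_vs (set (cols A)) = module_vec TYPE('a) n"
      by (simp add: module_vec_def)
    then show "rank A = n"
      unfolding rank_def using dim_is_n by simp
  qed
qed

lemma full_row_rank_iff_surj:
  fixes C :: "'a::field mat"
  assumes "C \<in> carrier_mat n m"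
  shows "vec_space.rank n C = n \<longleftrightarrow> (\<forall>y\<in>carrier_vec n. \<exists>x\<in>carrier_vec m. C *\<^sub>v x = y)"
proof -
  interpret vec_space "TYPE('a)" n .
  have "span (set (cols C)) = {y \<in> carrier_vec n. \<exists>x\<in>carrier_vec m. C *\<^sub>v x = y}"
    using col_space_eq[OF assms] assms unfolding col_space_def by simp
  then show ?thesis
    unfolding rank_eq_dim_iff_span[OF assms] by blast
qed

lemma scalar_prod_self_eq_0:
  fixes v :: "real vec"
  assumes "v \<in> carrier_vec n" and "v \<bullet> v = 0"
  shows "v = 0\<^sub>v n"
proof -
  have "(\<Sum>i\<in>{0..<n}. v $ i * v $ i) = 0"
    using assms unfolding scalar_prod_def by simp
  then have "\<forall>i\<in>{0..<n}. v $ i * v $ i = 0"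
    by (subst (asm) sum_nonneg_eq_0_iff) auto
  then show ?thesis
    using assms(1) by (intro eq_vecI) auto
qed

text \<open>
  Over the reals, \<open>C C^T v = 0\<close> implies \<open>\<bar>C^T v\<bar>\<^sup>2 = 0\<close>. The Gram determinant replaces
  a choice of maximal minor: it is one continuous function that detects full row rank.
\<close>

lemma gram_det_neq_0_iff:
  fixes C :: "real mat"
  assumes C: "C \<in> carrier_mat n m"
  shows "det (C * C\<^sup>T) \<noteq> 0 \<longleftrightarrow> (\<forall>v\<in>carrier_vec n. C\<^sup>T *\<^sub>v v = 0\<^sub>v m \<longrightarrow> v = 0\<^sub>v n)"
proof -
  have CC: "C * C\<^sup>T \<in> carrier_mat n n"
    using C by simp
  have "(C * C\<^sup>T) *\<^sub>v v = 0\<^sub>v n \<longleftrightarrow> C\<^sup>T *\<^sub>v v = 0\<^sub>v m" if v: "v \<in> carrier_vec n" for v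
  proof
    assume "(C * C\<^sup>T) *\<^sub>v v = 0\<^sub>v n"
    then have "C *\<^sub>v (C\<^sup>T *\<^sub>v v) = 0\<^sub>v n"
      using C v by (simp add: assoc_mult_mat_vec)
    then have "(C\<^sup>T *\<^sub>v v) \<bullet> (C\<^sup>T *\<^sub>v v) = 0"
      using transpose_vec_mult_scalar[OF C, of "C\<^sup>T *\<^sub>v v" v] C v by simp
    then show "C\<^sup>T *\<^sub>v v = 0\<^sub>v m"
      using scalar_prod_self_eq_0[of "C\<^sup>T *\<^sub>v v" m] C v by simp
  next
    assume "C\<^sup>T *\<^sub>v v = 0\<^sub>v m"
    then show "(C * C\<^sup>T) *\<^sub>v v = 0\<^sub>v n"
      using C v by (auto simp: assoc_mult_mat_vec[of C n m "C\<^sup>T" n v])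
  qed
  then show ?thesis
    unfolding det_0_iff_vec_prod_zero_field[OF CC] by blast
qed

lemma full_row_rank_iff_gram_det:
  fixes C :: "real mat"
  assumes C: "C \<in> carrier_mat n m"
  shows "vec_space.rank n C = n \<longleftrightarrow> det (C * C\<^sup>T) \<noteq> 0"
proof
  assume rank: "vec_space.rank n C = n"
  have "v = 0\<^sub>v n" if v: "v \<in> carrier_vec n" and 0: "C\<^sup>T *\<^sub>v v = 0\<^sub>v m" for v
  proof -
    obtain x where x: "x \<in> carrier_vec m" "C *\<^sub>v x = v"
      using rank v unfolding full_row_rank_iff_surj[OF C] by blast
    have "v \<bullet> v = (C\<^sup>T *\<^sub>v v) \<bullet> x"
      using transpose_vec_mult_scalar[OF C x(1) v] x(2) by simp
    then show ?thesis
      using scalar_prod_self_eq_0[OF v] 0 x(1) by simp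
  qed
  then show "det (C * C\<^sup>T) \<noteq> 0"
    unfolding gram_det_neq_0_iff[OF C] by blast
next
  assume "det (C * C\<^sup>T) \<noteq> 0"
  have CC: "C * C\<^sup>T \<in> carrier_mat n n"
    using C by simp
  have "vec_space.rank n (C * C\<^sup>T) = n"
    using \<open>det (C * C\<^sup>T) \<noteq> 0\<close> vec_space.det_rank_iff[OF CC] by blast
  then have surj: "\<exists>x\<in>carrier_vec n. (C * C\<^sup>T) *\<^sub>v x = y" if "y \<in> carrier_vec n" for y
    using that unfolding full_row_rank_iff_surj[OF CC] by blast
  show "vec_space.rank n C = n"
    unfolding full_row_rank_iff_surj[OF C]
  proof
    fix y :: "real vec" assume "y \<in> carrier_vec n"
    then obtain x where x: "x \<in> carrier_vec n" "(C * C\<^sup>T) *\<^sub>v x = y"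
      using surj by blast
    then have "C *\<^sub>v (C\<^sup>T *\<^sub>v x) = y"
      using C by (simp add: assoc_mult_mat_vec)
    then show "\<exists>x\<in>carrier_vec m. C *\<^sub>v x = y"
      using C x(1) by (intro bexI[of _ "C\<^sup>T *\<^sub>v x"]) auto
  qed
qed

section \<open>Controllability as dual observability\<close>

abbreviation entries :: "'a mat \<Rightarrow> nat \<Rightarrow> nat \<Rightarrow> 'a" where
  "entries A \<equiv> \<lambda>i j. A $$ (i, j)"

lemma adjoint_op_funpow_mat:
  fixes A B :: "real mat"
  assumes A: "A \<in> carrier_mat n n" and B: "B \<in> carrier_mat n n" and j: "j < n"
  shows "(\<Sum>i<n. x i * (A ^\<^sub>m k * B) $$ (i, j)) =
    (\<Sum>i<n. (adjoint_op {0..<n} (entries A) ^^ k) x i * B $$ (i, j))"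
  using B
proof (induction k arbitrary: B)
  case 0
  then show ?case using A by simp
next
  case (Suc k)
  let ?y = "(adjoint_op {0..<n} (entries A) ^^ k) x"
  have Ak: "A ^\<^sub>m k \<in> carrier_mat n n"
    using A by simp
  have "A ^\<^sub>m Suc k * B = A ^\<^sub>m k * (A * B)"
    using assoc_mult_mat[OF Ak A Suc.prems] by simp
  then have "(\<Sum>i<n. x i * (A ^\<^sub>m Suc k * B) $$ (i, j)) = (\<Sum>l<n. ?y l * (A * B) $$ (l, j))"
    using Suc.IH[of "A * B"] A Suc.prems by simp
  also have "\<dots> = (\<Sum>l<n. \<Sum>i<n. ?y l * (A $$ (l, i) * B $$ (i, j)))"
    using A Suc.prems j
    by (intro sum.cong) (auto simp: scalar_prod_def sum_distrib_left atLeast0LessThan)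
  also have "\<dots> = (\<Sum>i<n. adjoint_op {0..<n} (entries A) ?y i * B $$ (i, j))"
    by (subst sum.swap) (simp add: adjoint_op_def sum_distrib_left atLeast0LessThan mult_ac)
  finally show ?case by simp
qed

text \<open>
  Full row rank of the controllability matrix means that no nonzero row vector is orthogonal to all
  its columns, and pairing \<open>x\<close> with column \<open>k n + j\<close> is pairing its \<open>k\<close>th iterate with column
  \<open>j\<close> of \<open>B\<close>.
\<close>

lemma controllable_iff_adjoint_op:
  fixes A B :: "real mat"
  assumes A: "A \<in> carrier_mat n n" and B: "B \<in> carrier_mat n n"
  shows "controllable n A B \<longleftrightarrow>
    (\<forall>x. (\<forall>k<n. \<forall>j<n. (\<Sum>i<n. (adjoint_op {0..<n} (entries A) ^^ k) x i * B $$ (i, j)) = 0) \<longrightarrow>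
      (\<forall>i<n. x i = 0))" (is "_ \<longleftrightarrow> (\<forall>x. ?P x \<longrightarrow> ?Z x)")
proof -
  let ?C = "controllability_mat n A B"
  have C: "?C \<in> carrier_mat n (n * n)"
    by (simp add: controllability_mat_def)
  have entry: "(?C\<^sup>T *\<^sub>v v) $ c =
      (\<Sum>i<n. (adjoint_op {0..<n} (entries A) ^^ (c div n)) (\<lambda>i. v $ i) i * B $$ (i, c mod n))"
    if v: "v \<in> carrier_vec n" and c: "c < n * n" for v c
  proof -
    have "0 < n" using c by (cases n) auto
    have "(?C\<^sup>T *\<^sub>v v) $ c = (\<Sum>i<n. v $ i * (A ^\<^sub>m (c div n) * B) $$ (i, c mod n))"
      using v c by (simp add: controllability_mat_def scalar_prod_def atLeast0LessThan mult.commute)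
    then show ?thesis
      using adjoint_op_funpow_mat[OF A B, of "c mod n" "\<lambda>i. v $ i" "c div n"] \<open>0 < n\<close> by simp
  qed
  have kernel: "?C\<^sup>T *\<^sub>v v = 0\<^sub>v (n * n) \<longleftrightarrow> ?P (\<lambda>i. v $ i)" if v: "v \<in> carrier_vec n" for v
  proof
    assume 0: "?C\<^sup>T *\<^sub>v v = 0\<^sub>v (n * n)"
    show "?P (\<lambda>i. v $ i)"
    proof (intro allI impI)
      fix k j assume kj: "k < n" "j < n"
      have "k * n + j < Suc k * n"
        using kj by simp
      also have "\<dots> \<le> n * n"
        using kj by (intro mult_le_mono1) simp
      finally have "k * n + j < n * n" .
      then show "(\<Sum>i<n. (adjoint_op {0..<n} (entries A) ^^ k) (\<lambda>i. v $ i) i * B $$ (i, j)) = 0"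
        using entry[OF v, of "k * n + j"] 0 kj by simp
    qed
  next
    assume P: "?P (\<lambda>i. v $ i)"
    show "?C\<^sup>T *\<^sub>v v = 0\<^sub>v (n * n)"
    proof (rule eq_vecI)
      fix c assume "c < dim_vec (0\<^sub>v (n * n) :: real vec)"
      then have c: "c < n * n" by simp
      then have "0 < n" by (cases n) auto
      then have "c div n < n" "c mod n < n"
        using c by (auto simp: less_mult_imp_div_less)
      then show "(?C\<^sup>T *\<^sub>v v) $ c = 0\<^sub>v (n * n) $ c"
        using entry[OF v c] P c by simp
    qed (use C in simp)
  qed
  have "controllable n A B \<longleftrightarrow> (\<forall>v\<in>carrier_vec n. ?P (\<lambda>i. v $ i) \<longrightarrow> v = 0\<^sub>v n)"
    unfolding controllable_def full_row_rank_iff_gram_det[OF C] gram_det_neq_0_iff[OF C]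
    using kernel by blast
  also have "\<dots> \<longleftrightarrow> (\<forall>x. ?P x \<longrightarrow> ?Z x)"
  proof
    assume *: "\<forall>v\<in>carrier_vec n. ?P (\<lambda>i. v $ i) \<longrightarrow> v = 0\<^sub>v n"
    show "\<forall>x. ?P x \<longrightarrow> ?Z x"
    proof (intro allI impI)
      fix x i assume P: "?P x" and i: "i < n"
      have "(adjoint_op {0..<n} (entries A) ^^ k) (\<lambda>i. vec n x $ i) i =
          (adjoint_op {0..<n} (entries A) ^^ k) x i" if "i < n" for k i
        using that by (intro adjoint_op_funpow_cong) auto
      then have "?P (\<lambda>i. vec n x $ i)"
        using P by simp
      then have "vec n x = 0\<^sub>v n"
        using * by simp
      then show "x i = 0"
        using i by (metis index_vec index_zero_vec(1))
    qed
  next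
    assume *: "\<forall>x. ?P x \<longrightarrow> ?Z x"
    show "\<forall>v\<in>carrier_vec n. ?P (\<lambda>i. v $ i) \<longrightarrow> v = 0\<^sub>v n"
    proof (intro ballI impI)
      fix v :: "real vec" assume v: "v \<in> carrier_vec n" and "?P (\<lambda>i. v $ i)"
      then have "?Z (\<lambda>i. v $ i)"
        using * by blast
      then show "v = 0\<^sub>v n"
        using v by (intro eq_vecI) auto
    qed
  qed
  finally show ?thesis .
qed

text \<open>
  The vectors \<open>x, T x, ..., T^n x\<close> are \<open>n + 1\<close> vectors in dimension \<open>n\<close>, hence dependent, and the
  last one with a nonzero coefficient is a combination of earlier ones. Shifting this
  relation expresses every iterate from the \<open>n\<close>th on by earlier ones. The dependency is read off from
  a square matrix with an added zero row.
\<close>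

lemma unobservable_if_first_steps:
  fixes a :: "nat \<Rightarrow> nat \<Rightarrow> real"
  assumes S: "S \<subseteq> {0..<n}" and zero: "\<And>k s. k < n \<Longrightarrow> s \<in> S \<Longrightarrow> (adjoint_op {0..<n} a ^^ k) x s = 0"
  shows "unobservable {0..<n} a S x"
proof -
  let ?T = "adjoint_op {0..<n} a"
  define M where "M = mat (Suc n) (Suc n) (\<lambda>(i, k). if i < n then (?T ^^ k) x i else 0)"
  have M: "M \<in> carrier_mat (Suc n) (Suc n)"
    by (simp add: M_def)
  have "M\<^sup>T *\<^sub>v unit_vec (Suc n) n = 0\<^sub>v (Suc n)"
    by (rule eq_vecI) (auto simp: M_def)
  moreover have "unit_vec (Suc n) n \<noteq> (0\<^sub>v (Suc n) :: real vec)"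
    by simp
  ultimately have "det (M\<^sup>T) = 0"
    using det_0_iff_vec_prod_zero_field[of "M\<^sup>T" "Suc n"] M by (auto intro!: exI[of _ "unit_vec (Suc n) n"])
  then have "det M = 0"
    using det_transpose[OF M] by simp
  then obtain v where v: "v \<in> carrier_vec (Suc n)" "v \<noteq> 0\<^sub>v (Suc n)" "M *\<^sub>v v = 0\<^sub>v (Suc n)"
    using det_0_iff_vec_prod_zero_field[OF M] by blast
  define c where "c k = v $ k" for k
  have rel: "(\<Sum>k\<le>n. c k * (?T ^^ (k + l)) x i) = 0" if "i < n" for l i
    using that
  proof (induction l arbitrary: i)
    case 0
    have "(M *\<^sub>v v) $ i = (\<Sum>k\<le>n. c k * (?T ^^ k) x i)"
      using v(1) 0 unfolding M_def c_def
      by (simp add: scalar_prod_def atLeast0LessThan lessThan_Suc_atMost mult.commute)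
    then show ?case
      using v(3) 0 by simp
  next
    case (Suc l)
    have "(\<Sum>k\<le>n. c k * (?T ^^ (k + Suc l)) x i) =
        (\<Sum>k\<le>n. \<Sum>j\<in>{0..<n}. a j i * (c k * (?T ^^ (k + l)) x j))"
      by (simp add: adjoint_op_def sum_distrib_left mult_ac)
    also have "\<dots> = (\<Sum>j\<in>{0..<n}. a j i * (\<Sum>k\<le>n. c k * (?T ^^ (k + l)) x j))"
      by (subst sum.swap) (simp add: sum_distrib_left)
    also have "\<dots> = 0"
      using Suc.IH by simp
    finally show ?case .
  qed
  have "\<exists>k\<le>n. c k \<noteq> 0"
  proof (rule ccontr)
    assume "\<not> ?thesis"
    then have "v = 0\<^sub>v (Suc n)"
      using v(1) unfolding c_def by (intro eq_vecI) auto
    then show False using v(2) by blast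
  qed
  then have ne: "finite {k. k \<le> n \<and> c k \<noteq> 0}" "{k. k \<le> n \<and> c k \<noteq> 0} \<noteq> {}"
    by auto
  define m where "m = Max {k. k \<le> n \<and> c k \<noteq> 0}"
  have m: "m \<le> n" "c m \<noteq> 0"
    using Max_in[OF ne] unfolding m_def by auto
  have above: "c k = 0" if "m < k" "k \<le> n" for k
  proof (rule ccontr)
    assume "c k \<noteq> 0"
    then have "k \<le> m"
      unfolding m_def using that(2) ne(1) by (intro Max_ge) auto
    then show False using that(1) by simp
  qed
  have "(?T ^^ K) x s = 0" if s: "s \<in> S" for K s
  proof (induction K rule: less_induct)
    case (less K)
    show ?case
    proof (cases "K < n")
      case True
      then show ?thesis using zero s by blast
    next
      case False
      define l where "l = K - m"
      have K: "K = m + l"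
        using False m(1) by (simp add: l_def)
      have "0 = (\<Sum>k\<le>n. c k * (?T ^^ (k + l)) x s)"
        using rel s S by (auto simp: subset_eq)
      also have "\<dots> = (\<Sum>k\<le>n. if k = m then c m * (?T ^^ K) x s else 0)"
      proof (rule sum.cong[OF refl])
        fix k assume "k \<in> {..n}"
        then show "c k * (?T ^^ (k + l)) x s = (if k = m then c m * (?T ^^ K) x s else 0)"
          using above[of k] less.IH[of "k + l"] K by (cases k m rule: linorder_cases) auto
      qed
      also have "\<dots> = c m * (?T ^^ K) x s"
        using m(1) by simp
      finally show ?thesis
        using m(2) by simp
    qed
  qed
  then show ?thesis
    unfolding unobservable_def by blast
qed

lemma controllable_diag_iff_observable:
  fixes A B :: "real mat"
  assumes A: "A \<in> carrier_mat n n" and B: "B \<in> carrier_mat n n" and S: "S \<subseteq> {0..<n}"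
    and diag: "\<And>i j. i < n \<Longrightarrow> j < n \<Longrightarrow> B $$ (i, j) \<noteq> 0 \<longleftrightarrow> i = j \<and> i \<in> S"
  shows "controllable n A B \<longleftrightarrow> observable {0..<n} (entries A) S"
proof -
  have column: "(\<Sum>i<n. y i * B $$ (i, j)) = 0 \<longleftrightarrow> j \<in> S \<longrightarrow> y j = 0" if "j < n" for y j
  proof -
    have "(\<Sum>i<n. y i * B $$ (i, j)) = (\<Sum>i<n. if i = j then y j * B $$ (j, j) else 0)"
      using diag that by (intro sum.cong) auto
    also have "\<dots> = y j * B $$ (j, j)"
      using that by simp
    finally show ?thesis
      using diag[OF that that] by auto
  qed
  have "(\<forall>k<n. \<forall>j<n. (\<Sum>i<n. (adjoint_op {0..<n} (entries A) ^^ k) x i * B $$ (i, j)) = 0) \<longleftrightarrow>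
      unobservable {0..<n} (entries A) S x" for x
    using unobservable_if_first_steps[OF S, of "entries A" x] column S
    unfolding unobservable_def by (auto simp: subset_eq)
  then show ?thesis
    unfolding controllable_iff_adjoint_op[OF A B] observable_def by (simp add: Ball_def)
qed

section \<open>Controllability is an open condition\<close>

lemma isCont_mult_mat_entry:
  fixes P Q :: "real \<Rightarrow> real mat"
  assumes "\<And>t. P t \<in> carrier_mat n m" and "\<And>t. Q t \<in> carrier_mat m l"
    and "\<And>i k. i < n \<Longrightarrow> k < m \<Longrightarrow> isCont (\<lambda>t. P t $$ (i, k)) t0"
    and "\<And>k j. k < m \<Longrightarrow> j < l \<Longrightarrow> isCont (\<lambda>t. Q t $$ (k, j)) t0"
    and "i < n" "j < l"
  shows "isCont (\<lambda>t. (P t * Q t) $$ (i, j)) t0"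
proof -
  have "(P t * Q t) $$ (i, j) = (\<Sum>k<m. P t $$ (i, k) * Q t $$ (k, j))" for t
    using assms(1)[of t] assms(2)[of t] assms(5,6) by (simp add: scalar_prod_def atLeast0LessThan)
  then show ?thesis
    using assms by (simp add: continuous_intros)
qed

lemma isCont_pow_mat_entry:
  fixes P :: "real \<Rightarrow> real mat"
  assumes "\<And>t. P t \<in> carrier_mat n n"
    and "\<And>i j. i < n \<Longrightarrow> j < n \<Longrightarrow> isCont (\<lambda>t. P t $$ (i, j)) t0"
    and "i < n" "j < n"
  shows "isCont (\<lambda>t. (P t ^\<^sub>m k) $$ (i, j)) t0"
  using assms(3,4)
proof (induction k arbitrary: i j)
  case 0
  have "dim_row (P t) = n" for t
    using assms(1)[of t] by simp
  then show ?case using 0 by simp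
next
  case (Suc k)
  have "isCont (\<lambda>t. (P t ^\<^sub>m k * P t) $$ (i, j)) t0"
    using assms(1,2) Suc pow_carrier_mat by (intro isCont_mult_mat_entry[of _ n n _ n]) auto
  then show ?case by simp
qed

lemma isCont_det:
  fixes P :: "real \<Rightarrow> real mat"
  assumes "\<And>t. P t \<in> carrier_mat n n"
    and "\<And>i j. i < n \<Longrightarrow> j < n \<Longrightarrow> isCont (\<lambda>t. P t $$ (i, j)) t0"
  shows "isCont (\<lambda>t. det (P t)) t0"
proof -
  have "isCont (\<lambda>t. \<Sum>p\<in>{p. p permutes {0..<n}}. signof p * (\<Prod>i=0..<n. P t $$ (i, p i))) t0"
  proof (intro continuous_intros)
    fix p i assume "p \<in> {p. p permutes {0..<n}}" "i \<in> {0..<n}"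
    then have "p i < n" "i < n"
      using permutes_in_image[of p "{0..<n}" i] by auto
    then show "isCont (\<lambda>t. P t $$ (i, p i)) t0"
      using assms(2) by blast
  qed
  then show ?thesis
    using det_def'[OF assms(1)] by simp
qed

text \<open>
  The entries of the controllability matrix are polynomials in those of \<open>P t\<close>, so its Gram
  determinant is continuous in \<open>t\<close>.
\<close>

lemma eventually_controllable:
  fixes P :: "real \<Rightarrow> real mat" and B :: "real mat"
  assumes P: "\<And>t. P t \<in> carrier_mat n n" and B: "B \<in> carrier_mat n n"
    and cont: "\<And>i j. i < n \<Longrightarrow> j < n \<Longrightarrow> isCont (\<lambda>t. P t $$ (i, j)) t0"
    and ctrl: "controllable n (P t0) B"
  shows "\<forall>\<^sub>F t in at t0. controllable n (P t) B"
proof -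
  let ?C = "\<lambda>t. controllability_mat n (P t) B"
  have C: "?C t \<in> carrier_mat n (n * n)" for t
    by (simp add: controllability_mat_def)
  have contC: "isCont (\<lambda>t. ?C t $$ (i, c)) t0" if "i < n" "c < n * n" for i c
  proof -
    have "c mod n < n"
      using that by (cases n) auto
    then have "isCont (\<lambda>t. (P t ^\<^sub>m (c div n) * B) $$ (i, c mod n)) t0"
      using that P B pow_carrier_mat isCont_pow_mat_entry[OF P cont]
      by (intro isCont_mult_mat_entry[of _ n n _ n]) auto
    then show ?thesis
      using that by (simp add: controllability_mat_def)
  qed
  have dims: "dim_row (?C t) = n" "dim_col (?C t) = n * n" for t
    using C[of t] by auto
  have "isCont (\<lambda>t. det (?C t * (?C t)\<^sup>T)) t0"
  proof (rule isCont_det)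
    show "isCont (\<lambda>t. (?C t * (?C t)\<^sup>T) $$ (i, j)) t0" if "i < n" "j < n" for i j
    proof (rule isCont_mult_mat_entry[of _ n "n * n" _ n])
      show "isCont (\<lambda>t. (?C t)\<^sup>T $$ (k, j)) t0" if "k < n * n" "j < n" for k j
        using contC[of j k] that by (simp add: dims)
    qed (use C contC that in auto)
    show "?C t * (?C t)\<^sup>T \<in> carrier_mat n n" for t
      using mult_carrier_mat[OF C transpose_carrier_mat[THEN iffD2, OF C]] .
  qed
  moreover have "det (?C t0 * (?C t0)\<^sup>T) \<noteq> 0"
    using ctrl full_row_rank_iff_gram_det[OF C] unfolding controllable_def by blast
  ultimately have "\<forall>\<^sub>F t in at t0. det (?C t * (?C t)\<^sup>T) \<noteq> 0"
    unfolding isCont_def by (rule tendsto_imp_eventually_ne)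
  then show ?thesis
    unfolding controllable_def full_row_rank_iff_gram_det[OF C] .
qed

text \<open>
  Adding \<open>t A\<close> to \<open>A0\<close> preserves controllability for small \<open>t\<close>, and apart from finitely
  many values of \<open>t\<close> it creates no zero at a nonzero entry of \<open>A\<close>.
\<close>

lemma controllable_perturb_to_pattern:
  fixes A A0 B :: "real mat"
  assumes A: "A \<in> carrier_mat n n" and A0: "A0 \<in> carrier_mat n n" and B: "B \<in> carrier_mat n n"
    and sub: "\<And>i j. i < n \<Longrightarrow> j < n \<Longrightarrow> A0 $$ (i, j) \<noteq> 0 \<Longrightarrow> A $$ (i, j) \<noteq> 0"
    and ctrl: "controllable n A0 B"
  shows "\<exists>A'\<in>carrier_mat n n. controllable n A' B \<and>
    (\<forall>i<n. \<forall>j<n. A' $$ (i, j) = 0 \<longleftrightarrow> A $$ (i, j) = 0)"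
proof -
  define P where "P t = mat n n (\<lambda>(i, j). A0 $$ (i, j) + t * A $$ (i, j))" for t
  have P: "P t \<in> carrier_mat n n" for t
    by (simp add: P_def)
  have "P 0 = A0"
    using A0 by (intro eq_matI) (auto simp: P_def)
  then have ev: "\<forall>\<^sub>F t in at 0. controllable n (P t) B"
    using P B ctrl by (intro eventually_controllable) (auto simp: P_def)
  have "\<forall>\<^sub>F t in at 0. A0 $$ (i, j) + t * A $$ (i, j) = 0 \<longleftrightarrow> A $$ (i, j) = 0"
    if "i < n" "j < n" for i j
  proof (cases "A $$ (i, j) = 0")
    case True
    then show ?thesis using sub[OF that] by auto
  next
    case False
    have "\<forall>\<^sub>F t in at 0. t \<noteq> - A0 $$ (i, j) / A $$ (i, j)"
      by (rule eventually_neq_at_within)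
    then show ?thesis
      using False by (elim eventually_mono) (auto simp: field_simps)
  qed
  then have "\<forall>\<^sub>F t in at 0. \<forall>i\<in>{..<n}. \<forall>j\<in>{..<n}.
      A0 $$ (i, j) + t * A $$ (i, j) = 0 \<longleftrightarrow> A $$ (i, j) = 0"
    by (intro eventually_ball_finite ballI) auto
  with ev have "\<forall>\<^sub>F t in at 0. controllable n (P t) B \<and> (\<forall>i\<in>{..<n}. \<forall>j\<in>{..<n}.
      A0 $$ (i, j) + t * A $$ (i, j) = 0 \<longleftrightarrow> A $$ (i, j) = 0)"
    by (rule eventually_conj)
  then obtain t :: real where "controllable n (P t) B"
    "\<And>i j. i < n \<Longrightarrow> j < n \<Longrightarrow> A0 $$ (i, j) + t * A $$ (i, j) = 0 \<longleftrightarrow> A $$ (i, j) = 0"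
    using eventually_happens'[OF at_neq_bot] by fastforce
  then show ?thesis
    using P by (intro bexI[of _ "P t"]) (auto simp: P_def)
qed

section \<open>Structural controllability and the matroid\<close>

lemma same_structure_iff:
  assumes "A \<in> carrier_mat n n" "B \<in> carrier_mat n n" "A' \<in> carrier_mat n n" "B' \<in> carrier_mat n n"
  shows "same_structure (A', B') (A, B) \<longleftrightarrow>
    (\<forall>i<n. \<forall>j<n. (A' $$ (i, j) = 0 \<longleftrightarrow> A $$ (i, j) = 0) \<and> (B' $$ (i, j) = 0 \<longleftrightarrow> B $$ (i, j) = 0))"
proof -
  have dims: "dim_row (append_cols M N) = n" "dim_col (append_cols M N) = n + n"
    if "M \<in> carrier_mat n n" "N \<in> carrier_mat n n" for M N :: "real mat"
    using that by (auto simp: append_cols_def)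
  have left: "append_cols M N $$ (i, j) = M $$ (i, j)"
    and right: "append_cols M N $$ (i, n + j) = N $$ (i, j)"
    if "M \<in> carrier_mat n n" "N \<in> carrier_mat n n" "i < n" "j < n" for M N :: "real mat" and i j
    using that by (auto simp: append_cols_def)
  have split: "(\<forall>j<n + n. Q j) \<longleftrightarrow> (\<forall>j<n. Q j \<and> Q (n + j))" for Q :: "nat \<Rightarrow> bool"
  proof
    assume *: "\<forall>j<n. Q j \<and> Q (n + j)"
    show "\<forall>j<n + n. Q j"
    proof (intro allI impI)
      fix j assume "j < n + n"
      then show "Q j"
        using * by (cases "j < n") (auto dest!: spec[of _ "j - n"])
    qed
  qed auto
  show ?thesis
    unfolding same_structure_def same_zeros_def using assms
    by (simp add: dims split left right)
qed

lemma strongly_connected_crosses_cut: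
  assumes sc: "strongly_connected (with_proj (matrix_digraph n A))"
    and U: "U \<noteq> {}" "U \<subset> {0..<n}"
  shows "\<exists>u\<in>U. \<exists>c\<in>{0..<n} - U. A $$ (c, u) \<noteq> 0"
proof (rule ccontr)
  assume no: "\<not> ?thesis"
  obtain u v where u: "u \<in> U" and v: "v \<in> {0..<n} - U"
    using U by blast
  have "u \<in> {0..<n}"
    using u U(2) by blast
  then have "u \<rightarrow>\<^sup>*\<^bsub>with_proj (matrix_digraph n A)\<^esub> v"
    using sc v unfolding strongly_connected_def by (simp add: matrix_digraph_def)
  then have "(u, v) \<in> {(j, i). i < n \<and> j < n \<and> A $$ (i, j) \<noteq> 0}\<^sup>*"
    using reachable_rtranclI by (fastforce simp: matrix_digraph_def)
  then have "v \<in> U"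
  proof (induction rule: rtrancl_induct)
    case (step y z)
    then have "A $$ (z, y) \<noteq> 0" "z \<in> {0..<n}"
      by auto
    then show ?case using no step.IH by blast
  qed (use u in simp)
  then show False using v by blast
qed

text \<open>
  If \<open>S\<close> is empty, every vector is invisible, and a dependency among the rows outside \<open>S\<close> is a
  vector that vanishes on \<open>S\<close> and is annihilated in one step. In the other direction, a nonempty \<open>S\<close>
  is what lets strong connectivity provide an edge out of every superset of \<open>S\<close> other than the
  whole vertex set.
\<close>

lemma structurally_controllable_iff_matchable:
  assumes A: "A \<in> carrier_mat n n" and n: "n \<ge> 1"
    and sc: "strongly_connected (with_proj (matrix_digraph n A))"
    and S: "S \<subseteq> {0..<n}"
  shows "structurally_controllable n A (input_mat n S) \<longleftrightarrow>
    S \<noteq> {} \<and> matchable (\<lambda>i j. A $$ (i, j) \<noteq> 0) {0..<n} ({0..<n} - S)"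
proof
  have BS: "input_mat n S \<in> carrier_mat n n"
    by (simp add: input_mat_def)
  have BS_diag: "input_mat n S $$ (i, j) \<noteq> 0 \<longleftrightarrow> i = j \<and> i \<in> S" if "i < n" "j < n" for i j
    using that by (auto simp: input_mat_def)
  {
    assume "structurally_controllable n A (input_mat n S)"
    then obtain A' B' where A': "A' \<in> carrier_mat n n" and B': "B' \<in> carrier_mat n n"
      and ctrl: "controllable n A' B'" and same: "same_structure (A', B') (A, input_mat n S)"
      unfolding structurally_controllable_def by blast
    have pat: "A' $$ (i, j) = 0 \<longleftrightarrow> A $$ (i, j) = 0"
      "B' $$ (i, j) = 0 \<longleftrightarrow> input_mat n S $$ (i, j) = 0" if "i < n" "j < n" for i j
      using same that unfolding same_structure_iff[OF A BS A' B'] by blast+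
    have "B' $$ (i, j) \<noteq> 0 \<longleftrightarrow> i = j \<and> i \<in> S" if "i < n" "j < n" for i j
      using pat(2)[OF that] BS_diag[OF that] by blast
    then have obs: "observable {0..<n} (entries A') S"
      using ctrl controllable_diag_iff_observable[OF A' B' S] by blast
    have "S \<noteq> {}"
    proof
      assume "S = {}"
      then have "unobservable {0..<n} (entries A') S (\<lambda>_. 1)"
        by (simp add: unobservable_def)
      then show False
        using obs n unfolding observable_def by force
    qed
    moreover have "matchable (\<lambda>i j. A' $$ (i, j) \<noteq> 0) {0..<n} ({0..<n} - S)"
    proof (rule independent_rows_imp_matchable)
      fix x assume x: "\<forall>j\<in>{0..<n}. (\<Sum>r\<in>{0..<n} - S. x r * A' $$ (r, j)) = 0"
      define y where "y i = (if i \<in> S then 0 else x i)" for i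
      have Ty: "adjoint_op {0..<n} (entries A') y j = 0" if "j < n" for j
      proof -
        have "adjoint_op {0..<n} (entries A') y j = (\<Sum>i\<in>{0..<n} - S. x i * A' $$ (i, j))"
          unfolding adjoint_op_def using S by (intro sum.mono_neutral_cong_right) (auto simp: y_def)
        then show ?thesis
          using x that by simp
      qed
      have "(adjoint_op {0..<n} (entries A') ^^ k) y s = 0" if s: "s \<in> S" for k s
      proof -
        have "(adjoint_op {0..<n} (entries A') ^^ Suc m) y j = 0" if "j < n" for m j
          using that
        proof (induction m arbitrary: j)
          case 0
          then show ?case using Ty by simp
        next
          case (Suc m)
          then show ?case
            by (subst funpow.simps, subst comp_apply, subst adjoint_op_def) (simp del: funpow.simps)
        qed
        then show ?thesis
          using s S by (cases k) (auto simp: y_def subset_eq)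
      qed
      then have "\<forall>i\<in>{0..<n}. y i = 0"
        using obs unfolding observable_def unobservable_def by blast
      then show "\<forall>r\<in>{0..<n} - S. x r = 0"
        unfolding y_def by auto
    qed auto
    then have "matchable (\<lambda>i j. A $$ (i, j) \<noteq> 0) {0..<n} ({0..<n} - S)"
      using pat(1) unfolding matchable_def by (auto simp: image_subset_iff)
    ultimately show "S \<noteq> {} \<and> matchable (\<lambda>i j. A $$ (i, j) \<noteq> 0) {0..<n} ({0..<n} - S)"
      by blast
  }
  assume *: "S \<noteq> {} \<and> matchable (\<lambda>i j. A $$ (i, j) \<noteq> 0) {0..<n} ({0..<n} - S)"
  have "\<exists>a. observable {0..<n} a S \<and> (\<forall>i\<in>{0..<n}. \<forall>j\<in>{0..<n}. a i j \<noteq> 0 \<longrightarrow> A $$ (i, j) \<noteq> 0)"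
  proof (rule structural_observability)
    show "\<exists>u\<in>U. \<exists>c\<in>{0..<n} - U. A $$ (c, u) \<noteq> 0" if "S \<subseteq> U" "U \<subset> {0..<n}" for U
      using strongly_connected_crosses_cut[OF sc _ that(2)] that(1) * by blast
  qed (use S * in auto)
  then obtain a where a: "observable {0..<n} a S"
    "\<And>i j. i < n \<Longrightarrow> j < n \<Longrightarrow> a i j \<noteq> 0 \<Longrightarrow> A $$ (i, j) \<noteq> 0"
    by auto
  define A0 where "A0 = mat n n (\<lambda>(i, j). a i j)"
  have A0: "A0 \<in> carrier_mat n n"
    by (simp add: A0_def)
  have "adjoint_op {0..<n} (entries A0) y j = adjoint_op {0..<n} a y j" if "j < n" for y j
    unfolding adjoint_op_def A0_def using that by simp
  then have "(adjoint_op {0..<n} (entries A0) ^^ k) y j = (adjoint_op {0..<n} a ^^ k) y j"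
    if "j < n" for k y j
    using that
  proof (induction k arbitrary: j)
    case (Suc k)
    then show ?case by (simp add: adjoint_op_def)
  qed simp
  then have "observable {0..<n} (entries A0) S"
    using a(1) S unfolding observable_def unobservable_def by (auto simp: subset_eq)
  then have "controllable n A0 (input_mat n S)"
    using controllable_diag_iff_observable[OF A0 BS S BS_diag] by blast
  then obtain A' where "A' \<in> carrier_mat n n" "controllable n A' (input_mat n S)"
    "\<forall>i<n. \<forall>j<n. A' $$ (i, j) = 0 \<longleftrightarrow> A $$ (i, j) = 0"
    using controllable_perturb_to_pattern[OF A A0 BS] a(2) by (auto simp: A0_def)
  then show "structurally_controllable n A (input_mat n S)"
    unfolding structurally_controllable_def using A BS
    by (intro bexI[of _ A'] bexI[of _ "input_mat n S"]) (auto simp: same_structure_iff)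
qed

text \<open>
  An empty actuated set is never controllable, so \<open>K > 0\<close>, and the sets in \<open>R_sets n A K\<close> are
  exactly the matchable sets of size \<open>n - K\<close>. A matchable augmentation \<open>insert y X\<close> is independent
  once it extends to that size, for which the rows of a base containing \<open>Y\<close> suffice.
\<close>

theorem proposition3:
  fixes n K :: nat and A :: "real mat"
  assumes "n \<ge> 1"
    and "A \<in> carrier_mat n n"
    and "strongly_connected (with_proj (matrix_digraph n A))"
    and "C_sets n A K \<noteq> {}"
  shows "matroid {0..<n} (R_tilde n A K)"
proof -
  let ?indep = "matchable (\<lambda>i j. A $$ (i, j) \<noteq> 0) {0..<n}"
  have C_iff: "S \<in> C_sets n A K \<longleftrightarrow>
      S \<subseteq> {0..<n} \<and> card S = K \<and> S \<noteq> {} \<and> ?indep ({0..<n} - S)" for S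
    unfolding C_sets_def
    using structurally_controllable_iff_matchable[OF assms(2,1,3), of S] by blast
  obtain S0 where S0: "S0 \<in> C_sets n A K"
    using assms(4) by blast
  then have K: "0 < K" "K \<le> n"
    using C_iff[of S0] finite_subset[of S0 "{0..<n}"] card_mono[of "{0..<n}" S0]
    by (auto simp: card_gt_0_iff)
  have R_iff: "R \<in> R_sets n A K \<longleftrightarrow> R \<subseteq> {0..<n} \<and> card R = n - K \<and> ?indep R" for R
  proof (cases "R \<subseteq> {0..<n}")
    case True
    have "card R \<le> n"
      using card_mono[of "{0..<n}" R] True by simp
    moreover have "card ({0..<n} - R) = n - card R"
      using True by (subst card_Diff_subset) (auto intro: finite_subset)
    ultimately have "card ({0..<n} - R) = K \<longleftrightarrow> card R = n - K"
      using K by auto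
    moreover have "{0..<n} - R \<noteq> {}" if "card ({0..<n} - R) = K"
      using that K(1) by (metis card.empty less_irrefl)
    ultimately show ?thesis
      unfolding R_sets_def C_iff using True by (auto simp: double_diff)
  qed (auto simp: R_sets_def)
  show ?thesis
  proof
    show "X \<subseteq> {0..<n}" if "X \<in> R_tilde n A K" for X
      using that unfolding R_tilde_def R_sets_def by blast
    have "{0..<n} - S0 \<in> R_sets n A K"
      using S0 C_iff[of S0] unfolding R_sets_def by (auto simp: double_diff)
    then show "{} \<in> R_tilde n A K"
      unfolding R_tilde_def by blast
    show "Y \<in> R_tilde n A K" if "X \<in> R_tilde n A K" "Y \<subseteq> X" for X Y
      using that unfolding R_tilde_def by blast
    show "\<exists>y\<in>Y - X. insert y X \<in> R_tilde n A K"
      if X: "X \<in> R_tilde n A K" and Y: "Y \<in> R_tilde n A K" and less: "card X < card Y" for X Y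
    proof -
      obtain R1 R2 where R1: "R1 \<in> R_sets n A K" "X \<subseteq> R1" and R2: "R2 \<in> R_sets n A K" "Y \<subseteq> R2"
        using X Y unfolding R_tilde_def by blast
      have fin: "finite X" "finite Y" "finite R2"
        using R1 R2 finite_subset unfolding R_iff by (metis finite_atLeastLessThan)+
      obtain y where y: "y \<in> Y - X" "?indep (insert y X)"
        using matchable_augment[OF fin(1,2) _ _ less] R1 R2 matchable_mono unfolding R_iff by blast
      have "card (insert y X) \<le> card Y"
        using y(1) fin(1) less by simp
      also have "\<dots> \<le> card R2"
        using R2(2) fin(3) card_mono by blast
      finally obtain Z where Z: "insert y X \<subseteq> Z" "Z \<subseteq> insert y X \<union> R2" "card Z = card R2" "?indep Z"
        using matchable_extend[OF _ fin(3) y(2)] fin(1) R2(1) unfolding R_iff by blast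
      moreover have "insert y X \<union> R2 \<subseteq> {0..<n}"
        using R1 R2 y(1) unfolding R_iff by blast
      ultimately have "Z \<in> R_sets n A K"
        using R2(1) unfolding R_iff by (metis subset_trans)
      then show ?thesis
        using y(1) Z(1) unfolding R_tilde_def by blast
    qed
  qed simp
qed

end
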